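(* For every $n\times n$ real matrix $A=(a_{i,j})\in\mathcal M_n(\mathbb R)$, $$\lim_{p\to\infty}|A|_p=\mathop{\boxplus}_{\sigma\in S_n}\Big(\operatorname{sgn}(\sigma)\prod_{i\in[n]}a_{i,\sigma(i)}\Big),$$ where $\boxplus$-sums are written $\mathop{\boxplus}$. This limit is denoted $|A|_\infty$.
   Context: $[n]=\{1,\dots,n\}$, $S_n$ is the set of permutations of $[n]$, and $t^{1/(2p+1)}$ denotes the real odd root of $t\in\mathbb R$. For a natural number $p$, the $\varphi_p$-determinant of $A$ is $|A|_p=\Big(\sum_{\sigma\in S_n}\operatorname{sgn}(\sigma)\prod_{i\in[n]}a_{i,\sigma(i)}^{2p+1}\Big)^{1/(2p+1)}$, i.e. the $(2p+1)$-th root of the ordinary determinant of the matrix $(a_{i,j}^{2p+1})_{i,j}$. The operation $\boxplus$ (written $\mathop{\boxplus}$ for families): for a finite family of reals $(x_i)_{i\in I}$ and $\alpha>0$ put $\xi(\alpha)=\mathrm{Card}\{i\in I:x_i=\alpha\}-\mathrm{Card}\{i\in I:x_i=-\alpha\}$. If $\xi(\alpha)=0$ for all $\alpha>0$, then $\mathop{\boxplus}_{i\in I}x_i=0$. Otherwise let $\alpha^\star$ be the largest $\alpha>0$ with $\xi(\alpha)\neq0$; then $\mathop{\boxplus}_{i\in I}x_i=\alpha^\star$ if $\xi(\alpha^\star)>0$ and $\mathop{\boxplus}_{i\in I}x_i=-\alpha^\star$ if $\xi(\alpha^\star)<0$. *)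

theory Defs
  imports "HOL-Analysis.Analysis"
begin

text \<open>
  An \<open>n \<times> n\<close> matrix is indexed by a finite type \<open>'n\<close> with \<open>CARD('n) = n\<close>, and \<open>S\<^sub>n\<close> is the set of
  permutations of \<open>UNIV :: 'n set\<close>. For odd \<open>k\<close>, \<open>root k t\<close> is the real \<open>k\<close>-th root of \<open>t\<close> also when
  \<open>t\<close> is negative.
\<close>

definition phi_det :: "nat \<Rightarrow> real ^ 'n ^ 'n \<Rightarrow> real" where
  "phi_det p A =
     root (2 * p + 1)
       (\<Sum>\<sigma> | \<sigma> permutes (UNIV :: 'n set).
          of_int (sign \<sigma>) * (\<Prod>i\<in>UNIV. (A $ i $ \<sigma> i) ^ (2 * p + 1)))"

lemma phi_det_eq_root_det:
  "phi_det p A = root (2 * p + 1) (det (\<chi> i j. (A $ i $ j) ^ (2 * p + 1)))"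
  by (simp add: phi_det_def det_def)

definition xi :: "('i \<Rightarrow> real) \<Rightarrow> 'i set \<Rightarrow> real \<Rightarrow> int" where
  "xi x I \<alpha> = int (card {i \<in> I. x i = \<alpha>}) - int (card {i \<in> I. x i = - \<alpha>})"

text \<open>Only meaningful for finite \<open>I\<close>; the maximum is then taken over a finite set (see below).\<close>

definition boxsum :: "('i \<Rightarrow> real) \<Rightarrow> 'i set \<Rightarrow> real" where
  "boxsum x I =
     (if \<forall>\<alpha>>0. xi x I \<alpha> = 0 then 0
      else let \<alpha>' = Max {\<alpha>. \<alpha> > 0 \<and> xi x I \<alpha> \<noteq> 0}
           in if xi x I \<alpha>' > 0 then \<alpha>' else - \<alpha>')"

lemma finite_xi_support:
  assumes "finite I"
  shows "finite {\<alpha>. \<alpha> > 0 \<and> xi x I \<alpha> \<noteq> 0}"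
proof (rule finite_subset)
  show "{\<alpha>. \<alpha> > 0 \<and> xi x I \<alpha> \<noteq> 0} \<subseteq> x ` I \<union> (\<lambda>i. - x i) ` I"
  proof
    fix \<alpha> assume a: "\<alpha> \<in> {\<alpha>. \<alpha> > 0 \<and> xi x I \<alpha> \<noteq> 0}"
    show "\<alpha> \<in> x ` I \<union> (\<lambda>i. - x i) ` I"
    proof (rule ccontr)
      assume n: "\<alpha> \<notin> x ` I \<union> (\<lambda>i. - x i) ` I"
      have "{i \<in> I. x i = \<alpha>} = {}" "{i \<in> I. x i = - \<alpha>} = {}"
        using n by force+
      then have "xi x I \<alpha> = 0"
        unfolding xi_def by (simp only: card.empty)
      with a show False by simp
    qed
  qed
  show "finite (x ` I \<union> (\<lambda>i. - x i) ` I)"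
    using assms by simp
qed

end

theory Submission
  imports Defs
begin

text \<open>
  Since \<open>2 * p + 1\<close> is odd, \<open>|A|\<^sub>p\<close> is the \<open>(2 * p + 1)\<close>-th root of the power sum
  \<open>\<Sum>\<^sub>\<sigma> x\<^sub>\<sigma> ^ (2 * p + 1)\<close> of the signed products \<open>x\<^sub>\<sigma>\<close> in the Leibniz expansion, and the claim holds
  for the power sums of every finite family of reals (\<open>root_odd_power_sum_tendsto_boxsum\<close>).

  In such a power sum opposite terms cancel, so that it equals \<open>\<Sum>\<^sub>\<alpha> \<xi>(\<alpha>) \<alpha> ^ (2 * p + 1)\<close>, summed
  over the finitely many \<open>\<alpha> > 0\<close> with \<open>\<xi>(\<alpha>) \<noteq> 0\<close> (\<open>sum_odd_function_eq_xi_sum\<close>). If there are none,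
  everything vanishes. Otherwise let \<open>m\<close> be the largest one. Dividing by \<open>m ^ (2 * p + 1)\<close> leaves a
  quantity that converges to \<open>\<xi>(m)\<close>, because all other ratios \<open>\<alpha> / m\<close> are less than 1. Its odd roots
  of growing order converge to the sign of this nonzero limit (\<open>odd_root_tendsto_sgn\<close>), so the roots
  of the power sum converge to \<open>m * sgn (\<xi>(m))\<close>, which is the value of the \<open>\<boxplus>\<close>-sum.
\<close>

text \<open>
  Write \<open>root k t = sgn t * \<bar>t\<bar> powr (1 / k)\<close>. Away from \<open>0\<close> the exponent tending to \<open>0\<close> wipes out
  the absolute value and leaves the sign; the hypothesis \<open>c \<noteq> 0\<close> gives continuity of both factors.
\<close>

lemma odd_root_tendsto_sgn:
  fixes c :: real
  assumes e: "e \<longlonglongrightarrow> c" and "c \<noteq> 0"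
  shows "(\<lambda>p. root (2 * p + 1) (e p)) \<longlonglongrightarrow> sgn c"
proof -
  have "filterlim (\<lambda>p. 2 * p + 1) at_top (at_top :: nat filter)"
    by (rule filterlim_subseq) (auto simp: strict_mono_def)
  then have "(\<lambda>p. 1 / real (2 * p + 1)) \<longlonglongrightarrow> 0"
    by (rule filterlim_compose[OF lim_1_over_n])
  then have "(\<lambda>p. \<bar>e p\<bar> powr (1 / real (2 * p + 1))) \<longlonglongrightarrow> \<bar>c\<bar> powr 0"
    using assms by (intro tendsto_powr tendsto_rabs) auto
  then have "(\<lambda>p. sgn (e p) * \<bar>e p\<bar> powr (1 / real (2 * p + 1))) \<longlonglongrightarrow> sgn c * \<bar>c\<bar> powr 0"
    using assms by (intro tendsto_mult tendsto_sgn) auto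
  moreover have "root (2 * p + 1) t = sgn t * \<bar>t\<bar> powr (1 / real (2 * p + 1))" for p t
  proof (cases "t = 0")
    case False
    have "root (2 * p + 1) t = sgn t * root (2 * p + 1) \<bar>t\<bar>"
      by (cases "t > 0") (use False in \<open>auto simp: real_root_minus abs_if sgn_if\<close>)
    then show ?thesis
      using False by (simp add: root_powr_inverse)
  qed simp
  ultimately show ?thesis
    using \<open>c \<noteq> 0\<close> by simp
qed

text \<open>
  Grouping the indices by \<open>\<alpha> = \<bar>x i\<bar>\<close>: an odd \<open>f\<close> contributes \<open>f \<alpha>\<close> for each \<open>x i = \<alpha>\<close> and
  \<open>- f \<alpha>\<close> for each \<open>x i = - \<alpha>\<close>, and the net count of these is \<open>\<xi>(\<alpha>)\<close>.
\<close>

lemma sum_odd_function_eq_xi_sum: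
  fixes f :: "real \<Rightarrow> real"
  assumes "finite I" and odd: "\<And>t. f (- t) = - f t"
  shows "(\<Sum>i\<in>I. f (x i)) = (\<Sum>\<alpha> | \<alpha> > 0 \<and> xi x I \<alpha> \<noteq> 0. of_int (xi x I \<alpha>) * f \<alpha>)"
proof -
  define P where "P = (\<lambda>i. \<bar>x i\<bar>) ` I - {0}"
  have "finite P" and P_pos: "\<And>\<alpha>. \<alpha> \<in> P \<Longrightarrow> \<alpha> > 0"
    using \<open>finite I\<close> by (auto simp: P_def)
  have f0: "f 0 = 0"
    using odd[of 0] by simp
  have xi_sum: "real_of_int (xi x I \<alpha>) * f \<alpha> =
      (\<Sum>i\<in>I. (if x i = \<alpha> then f \<alpha> else 0) - (if - x i = \<alpha> then f \<alpha> else 0))" for \<alpha>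
  proof -
    have "{i \<in> I. x i = - \<alpha>} = {i \<in> I. - x i = \<alpha>}" by auto
    then show ?thesis
      using \<open>finite I\<close>
      by (simp add: xi_def sum_subtractf sum.If_cases Int_def algebra_simps)
  qed
  have pointwise: "f (x i) =
      (\<Sum>\<alpha>\<in>P. (if x i = \<alpha> then f \<alpha> else 0) - (if - x i = \<alpha> then f \<alpha> else 0))" if "i \<in> I" for i
  proof -
    have "x i \<in> P \<longleftrightarrow> x i > 0" "- x i \<in> P \<longleftrightarrow> x i < 0"
      using P_pos that by (force simp: P_def)+
    then show ?thesis
      using \<open>finite P\<close> odd[of "x i"] f0
      by (cases "x i" "0 :: real" rule: linorder_cases) (auto simp: sum_subtractf)
  qed
  have "(\<Sum>i\<in>I. f (x i)) = (\<Sum>\<alpha>\<in>P. of_int (xi x I \<alpha>) * f \<alpha>)"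
    unfolding xi_sum by (subst sum.swap) (intro sum.cong refl pointwise)
  also have "\<dots> = (\<Sum>\<alpha> | \<alpha> > 0 \<and> xi x I \<alpha> \<noteq> 0. of_int (xi x I \<alpha>) * f \<alpha>)"
  proof (rule sum.mono_neutral_right[OF \<open>finite P\<close>])
    show "{\<alpha>. \<alpha> > 0 \<and> xi x I \<alpha> \<noteq> 0} \<subseteq> P"
    proof clarify
      fix \<alpha> :: real assume "\<alpha> > 0" and nz: "xi x I \<alpha> \<noteq> 0"
      show "\<alpha> \<in> P"
      proof (rule ccontr)
        assume "\<alpha> \<notin> P"
        then have "{i \<in> I. x i = \<alpha>} = {}" "{i \<in> I. x i = - \<alpha>} = {}"
          using \<open>\<alpha> > 0\<close> by (force simp: P_def)+
        with nz show False
          unfolding xi_def by (simp only: card.empty)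
      qed
    qed
  qed (use P_pos in auto)
  finally show ?thesis .
qed

lemma root_odd_power_sum_tendsto_boxsum:
  assumes "finite I"
  shows "(\<lambda>p. root (2 * p + 1) (\<Sum>i\<in>I. x i ^ (2 * p + 1))) \<longlonglongrightarrow> boxsum x I"
proof -
  define S where "S = {\<alpha>. \<alpha> > 0 \<and> xi x I \<alpha> \<noteq> 0}"
  have "finite S"
    unfolding S_def by (rule finite_xi_support[OF assms])
  have power_sum: "(\<Sum>i\<in>I. x i ^ (2 * p + 1)) = (\<Sum>\<alpha>\<in>S. of_int (xi x I \<alpha>) * \<alpha> ^ (2 * p + 1))" for p
    unfolding S_def by (rule sum_odd_function_eq_xi_sum[OF assms]) simp
  show ?thesis
  proof (cases "S = {}")
    case True
    then have "boxsum x I = 0"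
      by (auto simp: boxsum_def S_def)
    with True show ?thesis
      unfolding power_sum by simp
  next
    case False
    define m where "m = Max S"
    define c where "c = real_of_int (xi x I m)"
    define e where "e = (\<lambda>p. c + (\<Sum>\<alpha>\<in>S - {m}. of_int (xi x I \<alpha>) * (\<alpha> / m) ^ (2 * p + 1)))"
    have "m \<in> S"
      unfolding m_def using \<open>finite S\<close> False by (rule Max_in)
    then have "m > 0" "c \<noteq> 0"
      by (auto simp: S_def c_def)
    have "\<not> (\<forall>\<alpha>>0. xi x I \<alpha> = 0)"
      using \<open>m \<in> S\<close> by (auto simp: S_def)
    then have "boxsum x I = (if xi x I m > 0 then m else - m)"
      unfolding boxsum_def S_def[symmetric] m_def[symmetric] by (auto simp: Let_def)
    then have box: "boxsum x I = m * sgn c"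
      using \<open>c \<noteq> 0\<close> by (simp add: c_def sgn_if)
    have "(\<lambda>p. of_int (xi x I \<alpha>) * (\<alpha> / m) ^ (2 * p + 1)) \<longlonglongrightarrow> 0" if "\<alpha> \<in> S - {m}" for \<alpha>
    proof -
      have "\<alpha> \<le> m"
        unfolding m_def using \<open>finite S\<close> that by (intro Max_ge) auto
      then have "norm (\<alpha> / m) < 1"
        using that \<open>m > 0\<close> by (auto simp: S_def)
      then have "(\<lambda>n. (\<alpha> / m) ^ n) \<longlonglongrightarrow> 0"
        by (rule LIMSEQ_power_zero)
      moreover have "strict_mono (\<lambda>p :: nat. 2 * p + 1)"
        by (auto simp: strict_mono_def)
      ultimately have "(\<lambda>p. (\<alpha> / m) ^ (2 * p + 1)) \<longlonglongrightarrow> 0"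
        by (rule LIMSEQ_subseq_LIMSEQ[unfolded comp_def])
      then show ?thesis
        by (rule tendsto_mult_right_zero)
    qed
    then have "e \<longlonglongrightarrow> c + 0"
      unfolding e_def by (intro tendsto_add tendsto_const tendsto_null_sum)
    then have "(\<lambda>p. m * root (2 * p + 1) (e p)) \<longlonglongrightarrow> m * sgn c"
      using \<open>c \<noteq> 0\<close> by (intro tendsto_mult_left odd_root_tendsto_sgn) auto
    moreover have "root (2 * p + 1) (\<Sum>i\<in>I. x i ^ (2 * p + 1)) = m * root (2 * p + 1) (e p)" for p
    proof -
      have "(\<Sum>i\<in>I. x i ^ (2 * p + 1)) = m ^ (2 * p + 1) * e p"
        unfolding power_sum e_def c_def sum.remove[OF \<open>finite S\<close> \<open>m \<in> S\<close>] distrib_left sum_distrib_left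
        using \<open>m > 0\<close> by (simp add: power_divide del: power_Suc)
      then show ?thesis
        using \<open>m > 0\<close> by (simp add: real_root_mult real_root_power_cancel del: power_Suc)
    qed
    ultimately show ?thesis
      by (simp add: box)
  qed
qed

theorem proposition3p2p2:
  fixes A :: "real ^ 'n ^ 'n"
  shows "(\<lambda>p. phi_det p A) \<longlonglongrightarrow>
    boxsum (\<lambda>\<sigma>. of_int (sign \<sigma>) * (\<Prod>i\<in>UNIV. A $ i $ \<sigma> i))
      {\<sigma>. \<sigma> permutes (UNIV :: 'n set)}"
proof -
  \<comment> \<open>An odd power leaves the sign of a permutation unchanged.\<close>
  have "real_of_int (sign \<sigma>) * (\<Prod>i\<in>UNIV. (A $ i $ \<sigma> i) ^ (2 * p + 1)) =
      (of_int (sign \<sigma>) * (\<Prod>i\<in>UNIV. A $ i $ \<sigma> i)) ^ (2 * p + 1)" for \<sigma> :: "'n \<Rightarrow> 'n" and p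
    unfolding power_mult_distrib prod_power_distrib by (simp add: sign_def)
  then show ?thesis
    unfolding phi_det_def
    by (simp only: root_odd_power_sum_tendsto_boxsum[OF finite_permutations[OF finite]])
qed

end
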